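(* Let $\xi_1,\eta_1,\xi_2,\eta_2,\dots$ be independent random variables, each taking the values $1$ and $-1$ with probability $\tfrac12$ each. Put $S_j=\sum_{i=1}^j \xi_i$ and $T_j=\sum_{i=1}^j\eta_i$ for $j\ge 1$, and $S_0=T_0=0$. Then for all integers $m\ge 0$, $n_1\ge 0$, $n_2\ge 0$, $$F(m;n_1,n_2)=4^m\,P\{S_j\ge 0,\ S_j\ge T_j \text{ for } 1\le j\le m,\ S_m=n_1,\ T_m=n_1-2n_2\}.$$ In particular, for all integers $n\ge 0$, $$F(2n;0,0)=4^{2n}\,P\{S_j\ge 0,\ S_j\ge T_j\text{ for }1\le j\le 2n,\ S_{2n}=T_{2n}=0\}.$$
   Context: For integers $m\ge 0$ and $n_1,n_2$, $F(m;n_1,n_2)$ denotes the number of Gessel walks with exactly $m$ steps from $(0,0)$ to $(n_1,n_2)$: lattice walks starting at the origin, each of whose $m$ steps is one of West $(-1,0)$, North-East $(1,1)$, East $(1,0)$, South-West $(-1,-1)$, and which remain in the first quadrant $\{(i,j): i\ge 0, j\ge 0\}$. In particular $F(m;n_1,n_2)=0$ if $n_1<0$ or $n_2<0$, and $F(0;n_1,n_2)=1$ if $n_1=n_2=0$ and $0$ otherwise. *)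

theory Defs
  imports "HOL-Probability.Probability"
begin

definition gessel_steps :: "(int \<times> int) set" where
  "gessel_steps = {(-1, 0), (1, 1), (1, 0), (-1, -1)}"

text \<open>A walk with \<open>m\<close> steps is the list of the \<open>m + 1\<close> lattice points it visits.\<close>

definition gessel_walks :: "nat \<Rightarrow> int \<Rightarrow> int \<Rightarrow> (int \<times> int) list set" where
  "gessel_walks m n1 n2 =
     {w. length w = m + 1 \<and> w ! 0 = (0, 0) \<and> w ! m = (n1, n2) \<and>
         (\<forall>i<m. w ! (i + 1) - w ! i \<in> gessel_steps) \<and>
         (\<forall>i\<le>m. fst (w ! i) \<ge> 0 \<and> snd (w ! i) \<ge> 0)}"

definition gessel_number :: "nat \<Rightarrow> int \<Rightarrow> int \<Rightarrow> nat" where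
  "gessel_number m n1 n2 = card (gessel_walks m n1 n2)"

definition partial_sum :: "(nat \<Rightarrow> 'a \<Rightarrow> real) \<Rightarrow> nat \<Rightarrow> 'a \<Rightarrow> real" where
  "partial_sum X j \<omega> = (\<Sum>i=1..j. X i \<omega>)"

end

(* A step (dx, dy) of a Gessel walk corresponds to the pair of signs (dx, dx - 2 dy); this is a
   bijection between the four steps and the four pairs of signs.  Hence a walk visiting (x, y) at
   time j has S_j = x and T_j = x - 2 y, the quadrant condition becomes S_j >= 0 and S_j >= T_j,
   and each of the 4^m sign patterns has probability 4^(-m). *)

theory Submission
  imports Defs
begin

section \<open>Steps and finiteness of the set of walks\<close>

text \<open>Used in both directions: forwards to see that a walk prescribes only values 1 and -1 for
  the variables, backwards to see that a path rebuilt from signs makes only Gessel steps.\<close>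

lemma gessel_step_iff:
  "d \<in> gessel_steps \<longleftrightarrow> fst d \<in> {1, -1} \<and> fst d - 2 * snd d \<in> {1, -1}"
  by (cases d) (auto simp: gessel_steps_def)

text \<open>A step raises either coordinate by at most 1, so the quadrant condition confines a walk
  to a box of side \<open>m\<close>. Finiteness makes \<open>card\<close> a genuine count and allows
  finite additivity over the walks.\<close>

lemma finite_gessel_walks: "finite (gessel_walks m n1 n2)"
proof (rule finite_subset)
  show "gessel_walks m n1 n2 \<subseteq>
      {w. set w \<subseteq> {0..int m} \<times> {0..int m} \<and> length w = m + 1}"
  proof
    fix w assume w: "w \<in> gessel_walks m n1 n2"
    have bound: "fst (w ! i) \<le> int i \<and> snd (w ! i) \<le> int i" if "i \<le> m" for i
      using that
    proof (induction i)
      case 0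
      then show ?case using w by (simp add: gessel_walks_def)
    next
      case (Suc i)
      have "w ! (i + 1) - w ! i \<in> gessel_steps"
        using w Suc.prems by (simp add: gessel_walks_def)
      then have "fst (w ! (i + 1) - w ! i) \<le> 1 \<and> snd (w ! (i + 1) - w ! i) \<le> 1"
        unfolding gessel_steps_def
        by (elim insertE emptyE) (simp_all only: fst_conv snd_conv, simp_all)
      with Suc show ?case by simp
    qed
    have nth_box: "w ! i \<in> {0..int m} \<times> {0..int m}" if "i \<le> m" for i
    proof -
      have "fst (w ! i) \<ge> 0 \<and> snd (w ! i) \<ge> 0"
        using w that by (simp add: gessel_walks_def)
      then show ?thesis
        using bound[OF that] that by (simp add: mem_Times_iff)
    qed
    have len: "length w = m + 1"
      using w by (simp add: gessel_walks_def)
    have "set w \<subseteq> {0..int m} \<times> {0..int m}"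
    proof
      fix p assume "p \<in> set w"
      then obtain i where "i \<le> m" "p = w ! i"
        using len by (metis in_set_conv_nth less_Suc_eq_le Suc_eq_plus1)
      then show "p \<in> {0..int m} \<times> {0..int m}"
        using nth_box by blast
    qed
    with len show "w \<in> {w. set w \<subseteq> {0..int m} \<times> {0..int m} \<and> length w = m + 1}"
      by blast
  qed
  show "finite {w. set w \<subseteq> {0..int m} \<times> {0..int m} \<and> length w = m + 1}"
    by (intro finite_lists_length_eq) auto
qed

section \<open>Partial sums and their increments\<close>

lemma partial_sum_0 [simp]: "partial_sum X 0 \<omega> = 0"
  by (simp add: partial_sum_def)

lemma partial_sum_Suc [simp]: "partial_sum X (Suc j) \<omega> = partial_sum X j \<omega> + X (Suc j) \<omega>"
  by (simp add: partial_sum_def)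

lemma borel_measurable_partial_sum:
  assumes "\<And>i. X (Suc i) \<in> borel_measurable M"
  shows "partial_sum X j \<in> borel_measurable M"
proof -
  have "X i \<in> borel_measurable M" if "i \<ge> 1" for i
    using assms[of "i - 1"] that by simp
  then show ?thesis
    unfolding partial_sum_def[abs_def] by (intro borel_measurable_sum) simp
qed

text \<open>Once the path is right up to time \<open>m\<close>, the next sum is right exactly if the
  next increment is. This turns an event about dependent sums into one about independent
  increments.\<close>

lemma partial_sum_path_iff:
  assumes "p 0 = 0"
  shows "(\<forall>j\<le>m. partial_sum X j \<omega> = p j) \<longleftrightarrow> (\<forall>i<m. X (Suc i) \<omega> = p (Suc i) - p i)"
proof (induction m)
  case 0
  then show ?case using assms by simp
next
  case (Suc m)
  have "(\<forall>j\<le>Suc m. partial_sum X j \<omega> = p j) \<longleftrightarrow>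
      (\<forall>j\<le>m. partial_sum X j \<omega> = p j) \<and> partial_sum X (Suc m) \<omega> = p (Suc m)"
    by (auto simp: le_Suc_eq simp del: partial_sum_Suc)
  also have "\<dots> \<longleftrightarrow>
      (\<forall>j\<le>m. partial_sum X j \<omega> = p j) \<and> X (Suc m) \<omega> = p (Suc m) - p m"
    by (intro conj_cong refl) (simp add: eq_diff_eq add.commute)
  finally have "(\<forall>j\<le>Suc m. partial_sum X j \<omega> = p j) \<longleftrightarrow>
      (\<forall>j\<le>m. partial_sum X j \<omega> = p j) \<and> X (Suc m) \<omega> = p (Suc m) - p m" .
  then show ?case
    using Suc by (auto simp: less_Suc_eq)
qed

section \<open>Probabilities of sign patterns\<close>

text \<open>The two sequences form one independent family over a sum type, so the pattern is an
  intersection of \<open>2 * m\<close> independent events of probability 1/2.\<close>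

lemma (in prob_space) prob_two_sign_patterns:
  fixes \<xi> \<eta> :: "nat \<Rightarrow> 'a \<Rightarrow> real"
  assumes indep: "indep_vars (\<lambda>_. borel) (case_sum \<xi> \<eta>) ({1..} <+> {1..})"
    and "\<And>i. i < m \<Longrightarrow> \<P>(\<omega> in M. \<xi> (Suc i) \<omega> = a i) = 1/2"
    and "\<And>i. i < m \<Longrightarrow> \<P>(\<omega> in M. \<eta> (Suc i) \<omega> = b i) = 1/2"
  shows "\<P>(\<omega> in M. \<forall>i<m. \<xi> (Suc i) \<omega> = a i \<and> \<eta> (Suc i) \<omega> = b i) = (1/4) ^ m"
\<comment> \<open>For \<open>m = 0\<close> the intersection over the empty index set would be
  \<open>UNIV\<close> instead of \<open>space M\<close>, so this case is treated apart.\<close>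
proof (cases "m = 0")
  case True
  then show ?thesis by (simp add: prob_space)
next
  case False
  \<comment> \<open>The variables are numbered from 1 and the prescribed values from 0; hence
    \<open>Suc\<close> in \<open>J\<close> and \<open>i - 1\<close> in \<open>c\<close>.\<close>
  define J where "J = Suc ` {..<m} <+> Suc ` {..<m}"
  define c where "c = case_sum (\<lambda>i. a (i - 1)) (\<lambda>i. b (i - 1))"
  have ball_J: "(\<forall>j\<in>J. P j) \<longleftrightarrow> (\<forall>i<m. P (Inl (Suc i)) \<and> P (Inr (Suc i)))" for P
    by (auto simp: J_def)
  have "{\<omega> \<in> space M. \<forall>i<m. \<xi> (Suc i) \<omega> = a i \<and> \<eta> (Suc i) \<omega> = b i} =
      (\<Inter>j\<in>J. case_sum \<xi> \<eta> j -` {c j} \<inter> space M)"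
    unfolding set_eq_iff INT_iff ball_J using False by (auto simp: c_def)
  also have "prob \<dots> = (\<Prod>j\<in>J. prob (case_sum \<xi> \<eta> j -` {c j} \<inter> space M))"
    using False by (intro indep_varsD[OF indep]) (auto simp: J_def)
  also have "\<dots> = (\<Prod>j\<in>J. 1/2)"
  proof (rule prod.cong[OF refl])
    fix j assume "j \<in> J"
    then show "prob (case_sum \<xi> \<eta> j -` {c j} \<inter> space M) = 1/2"
      using assms(2,3)
      by (auto simp: J_def c_def vimage_def Int_def conj_commute)
  qed
  also have "\<dots> = (1/2) ^ (m + m)"
    by (simp add: J_def card_Plus card_image)
  also have "\<dots> = (1/4 :: real) ^ m"
    by (simp add: power_add power_mult_distrib[symmetric])
  finally show ?thesis .
qed

text \<open>The two events are disjoint and their probabilities add up to 1. Only the distribution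
  of \<open>X\<close> is given, so other values can be excluded only up to a null set.\<close>

lemma (in prob_space) AE_two_values:
  fixes X :: "'a \<Rightarrow> real"
  assumes [measurable]: "random_variable borel X" and "a \<noteq> b"
    and "\<P>(\<omega> in M. X \<omega> = a) = 1/2" and "\<P>(\<omega> in M. X \<omega> = b) = 1/2"
  shows "AE \<omega> in M. X \<omega> = a \<or> X \<omega> = b"
proof -
  have "prob ({\<omega> \<in> space M. X \<omega> = a} \<union> {\<omega> \<in> space M. X \<omega> = b}) = 1"
    using assms by (subst finite_measure_Union) auto
  then have "AE \<omega> in M. \<omega> \<in> {\<omega> \<in> space M. X \<omega> = a} \<union> {\<omega> \<in> space M. X \<omega> = b}"
    by (intro prob_Collect_eq_1[THEN iffD1] AE_prob_1) simp_all
  then show ?thesis by auto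
qed

section \<open>Recovering the walk from the two real paths\<close>

text \<open>Pointwise inverse of the map from \<open>(x, y)\<close> to
  \<open>(x, x - 2 * y)\<close>. The floors only convert reals to integers; they are exact on the
  paths of interest.\<close>

definition walk_of :: "nat \<Rightarrow> (nat \<Rightarrow> real) \<Rightarrow> (nat \<Rightarrow> real) \<Rightarrow> (int \<times> int) list" where
  "walk_of m s t = map (\<lambda>j. (\<lfloor>s j\<rfloor>, \<lfloor>(s j - t j) / 2\<rfloor>)) [0..<m + 1]"

lemma length_walk_of [simp]: "length (walk_of m s t) = m + 1"
  by (simp add: walk_of_def)

lemma walk_of_nth [simp]: "j \<le> m \<Longrightarrow> walk_of m s t ! j = (\<lfloor>s j\<rfloor>, \<lfloor>(s j - t j) / 2\<rfloor>)"
  by (simp add: walk_of_def del: upt_Suc)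

lemma eq_walk_ofI:
  assumes "length w = m + 1"
    and "\<And>j. j \<le> m \<Longrightarrow> s j = of_int (fst (w ! j))"
    and "\<And>j. j \<le> m \<Longrightarrow> t j = of_int (fst (w ! j) - 2 * snd (w ! j))"
  shows "w = walk_of m s t"
  using assms by (intro nth_equalityI) (auto intro!: prod_eqI)

text \<open>Two sums of equally many signs have the same parity, so half their difference is an
  integer and the floors in \<open>walk_of\<close> lose nothing.\<close>

lemma walk_of_partial_sums:
  assumes "\<And>i. i < m \<Longrightarrow> X (Suc i) \<omega> \<in> {1, -1}" "\<And>i. i < m \<Longrightarrow> Y (Suc i) \<omega> \<in> {1, -1}"
    and "j \<le> m"
  defines "w \<equiv> walk_of m (\<lambda>j. partial_sum X j \<omega>) (\<lambda>j. partial_sum Y j \<omega>)"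
  shows "partial_sum X j \<omega> = of_int (fst (w ! j))"
    and "partial_sum Y j \<omega> = of_int (fst (w ! j) - 2 * snd (w ! j))"
proof -
  have *: "\<exists>x y :: int. partial_sum X j \<omega> = of_int x \<and> partial_sum Y j \<omega> = of_int (x - 2 * y)"
    using \<open>j \<le> m\<close>
  proof (induction j)
    case 0
    show ?case by (intro exI[of _ 0]) simp
  next
    case (Suc j)
    then obtain x y :: int
      where "partial_sum X j \<omega> = of_int x" "partial_sum Y j \<omega> = of_int (x - 2 * y)"
      by auto
    \<comment> \<open>The pair \<open>d\<close>, \<open>e\<close> is the lattice step encoded by the
      two signs; the four sign combinations are checked separately.\<close>
    moreover have "\<exists>d e :: int. X (Suc j) \<omega> = of_int d \<and> Y (Suc j) \<omega> = of_int (d - 2 * e)"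
    proof -
      have "X (Suc j) \<omega> = of_int d \<and> Y (Suc j) \<omega> = of_int (d - 2 * e)"
        if "d = \<lfloor>X (Suc j) \<omega>\<rfloor>" "e = \<lfloor>(X (Suc j) \<omega> - Y (Suc j) \<omega>) / 2\<rfloor>" for d e :: int
        using assms(1)[of j] assms(2)[of j] Suc.prems that by auto
      then show ?thesis by blast
    qed
    then obtain d e :: int
      where "X (Suc j) \<omega> = of_int d" "Y (Suc j) \<omega> = of_int (d - 2 * e)"
      by auto
    ultimately show ?case
      by (intro exI[of _ "x + d"] exI[of _ "y + e"]) simp
  qed
  then obtain x y :: int
    where "partial_sum X j \<omega> = of_int x" "partial_sum Y j \<omega> = of_int (x - 2 * y)"
    by auto
  then show "partial_sum X j \<omega> = of_int (fst (w ! j))"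
    "partial_sum Y j \<omega> = of_int (fst (w ! j) - 2 * snd (w ! j))"
    using \<open>j \<le> m\<close> by (simp_all add: w_def)
qed

section \<open>Decomposition of the event into walks\<close>

lemma (in prob_space) gessel_number_eq_prob:
  fixes \<xi> \<eta> :: "nat \<Rightarrow> 'a \<Rightarrow> real"
  assumes indep: "indep_vars (\<lambda>_. borel) (case_sum \<xi> \<eta>) ({1..} <+> {1..})"
    and \<xi>: "\<And>i. i \<ge> 1 \<Longrightarrow> \<P>(\<omega> in M. \<xi> i \<omega> = 1) = 1/2 \<and> \<P>(\<omega> in M. \<xi> i \<omega> = -1) = 1/2"
    and \<eta>: "\<And>i. i \<ge> 1 \<Longrightarrow> \<P>(\<omega> in M. \<eta> i \<omega> = 1) = 1/2 \<and> \<P>(\<omega> in M. \<eta> i \<omega> = -1) = 1/2"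
  shows "real (gessel_number m n1 n2) =
    4 ^ m * \<P>(\<omega> in M.
      (\<forall>j\<in>{1..m}. partial_sum \<xi> j \<omega> \<ge> 0 \<and> partial_sum \<xi> j \<omega> \<ge> partial_sum \<eta> j \<omega>) \<and>
      partial_sum \<xi> m \<omega> = of_int n1 \<and> partial_sum \<eta> m \<omega> = of_int (n1 - 2 * n2))"
proof -
  define W where "W = gessel_walks m n1 n2"
  define E where "E = {\<omega> \<in> space M.
      (\<forall>j\<in>{1..m}. partial_sum \<xi> j \<omega> \<ge> 0 \<and> partial_sum \<xi> j \<omega> \<ge> partial_sum \<eta> j \<omega>) \<and>
      partial_sum \<xi> m \<omega> = of_int n1 \<and> partial_sum \<eta> m \<omega> = of_int (n1 - 2 * n2)}"
  \<comment> \<open>\<open>A w\<close> is the event that the random path traces the walk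
    \<open>w\<close>.\<close>
  define A where "A w = {\<omega> \<in> space M.
      (\<forall>j\<le>m. partial_sum \<xi> j \<omega> = of_int (fst (w ! j))) \<and>
      (\<forall>j\<le>m. partial_sum \<eta> j \<omega> = of_int (fst (w ! j) - 2 * snd (w ! j)))}"
    for w :: "(int \<times> int) list"

  have rv: "random_variable borel (case_sum \<xi> \<eta> k)" if "k \<in> {1..} <+> {1..}" for k
    using indep that unfolding indep_vars_def by blast
  have rv_signs [measurable]: "random_variable borel (\<xi> (Suc i))"
    "random_variable borel (\<eta> (Suc i))" for i
    using rv[of "Inl (Suc i)"] rv[of "Inr (Suc i)"] by auto
  have [measurable]: "random_variable borel (partial_sum \<xi> j)"
    "random_variable borel (partial_sum \<eta> j)" for j
    by (rule borel_measurable_partial_sum, rule rv_signs)+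
  have sets [measurable]: "E \<in> sets M" "A w \<in> sets M" for w
    unfolding E_def A_def by measurable

  have steps: "w ! 0 = (0, 0)"
      "\<And>i. i < m \<Longrightarrow> w ! Suc i - w ! i \<in> gessel_steps"
      "\<And>i. i \<le> m \<Longrightarrow> fst (w ! i) \<ge> 0 \<and> snd (w ! i) \<ge> 0"
      "w ! m = (n1, n2)" "length w = m + 1" if "w \<in> W" for w
    using that by (auto simp: W_def gessel_walks_def)

  have prob_A: "prob (A w) = (1/4) ^ m" if w: "w \<in> W" for w
  proof -
    let ?d = "\<lambda>i. w ! Suc i - w ! i"
    \<comment> \<open>As \<open>w\<close> starts at the origin, both prescribed paths start at 0 and
      can be rewritten in terms of increments.\<close>
    have "A w = {\<omega> \<in> space M. \<forall>i<m. \<xi> (Suc i) \<omega> = of_int (fst (?d i)) \<and>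
        \<eta> (Suc i) \<omega> = of_int (fst (?d i) - 2 * snd (?d i))}"
      using steps(1)[OF w]
        partial_sum_path_iff[of "\<lambda>j. of_int (fst (w ! j))" m \<xi>]
        partial_sum_path_iff[of "\<lambda>j. of_int (fst (w ! j) - 2 * snd (w ! j))" m \<eta>]
      by (auto simp: A_def algebra_simps)
    also have "prob \<dots> = (1/4) ^ m"
    proof (rule prob_two_sign_patterns[OF indep])
      fix i assume "i < m"
      then have *: "fst (?d i) \<in> {1, -1}" "fst (?d i) - 2 * snd (?d i) \<in> {1, -1}"
        using steps(2)[OF w] gessel_step_iff by blast+
      show "\<P>(\<omega> in M. \<xi> (Suc i) \<omega> = of_int (fst (?d i))) = 1/2"
        using *(1) \<xi>[of "Suc i"] by (elim insertE emptyE) (simp_all only:, simp_all)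
      show "\<P>(\<omega> in M. \<eta> (Suc i) \<omega> = of_int (fst (?d i) - 2 * snd (?d i))) = 1/2"
        using *(2) \<eta>[of "Suc i"] by (elim insertE emptyE) (simp_all only:, simp_all)
    qed
    finally show ?thesis .
  qed

  \<comment> \<open>The outcome determines the walk that it traces, so distinct walks give disjoint
    events.\<close>
  have A_walk: "w = walk_of m (\<lambda>j. partial_sum \<xi> j \<omega>) (\<lambda>j. partial_sum \<eta> j \<omega>)"
    if "w \<in> W" "\<omega> \<in> A w" for w \<omega>
    using that steps(5)[OF that(1)] by (intro eq_walk_ofI) (simp_all add: A_def)
  have disj: "disjoint_family_on A W"
    unfolding disjoint_family_on_def using A_walk by blast

  \<comment> \<open>The variables are signs only almost surely, so \<open>E\<close> is identified
    with the union of the \<open>A w\<close> only up to a null set.\<close>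
  have "AE \<omega> in M. \<forall>i<m. \<xi> (Suc i) \<omega> \<in> {1, -1} \<and> \<eta> (Suc i) \<omega> \<in> {1, -1}"
  proof -
    have "AE \<omega> in M. \<xi> (Suc i) \<omega> = 1 \<or> \<xi> (Suc i) \<omega> = -1"
      and "AE \<omega> in M. \<eta> (Suc i) \<omega> = 1 \<or> \<eta> (Suc i) \<omega> = -1" for i
      using \<xi>[of "Suc i"] \<eta>[of "Suc i"] by (auto intro!: AE_two_values)
    then show ?thesis
      by (simp add: AE_all_countable)
  qed
  then have "AE \<omega> in M. \<omega> \<in> E \<longleftrightarrow> \<omega> \<in> (\<Union>w\<in>W. A w)"
  proof (rule AE_mp, intro AE_I2 impI iffI)
    fix \<omega> assume \<omega>: "\<omega> \<in> space M"
      and signs: "\<forall>i<m. \<xi> (Suc i) \<omega> \<in> {1, -1} \<and> \<eta> (Suc i) \<omega> \<in> {1, -1}"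
    {
      assume E: "\<omega> \<in> E"
      define w where "w = walk_of m (\<lambda>j. partial_sum \<xi> j \<omega>) (\<lambda>j. partial_sum \<eta> j \<omega>)"
      have S: "partial_sum \<xi> j \<omega> = of_int (fst (w ! j))"
        and T: "partial_sum \<eta> j \<omega> = of_int (fst (w ! j) - 2 * snd (w ! j))" if "j \<le> m" for j
        using walk_of_partial_sums[of m \<xi> \<omega> \<eta> j] signs that unfolding w_def by blast+
      have "w \<in> W"
        unfolding W_def gessel_walks_def
      proof (intro CollectI conjI allI impI)
        show "length w = m + 1" "w ! 0 = (0, 0)"
          by (simp_all add: w_def)
        \<comment> \<open>The second coordinate is half of
          \<open>n1 - (n1 - 2 * n2)\<close>.\<close>
        show "w ! m = (n1, n2)"
          using E by (simp add: w_def E_def)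
        fix i
        show "w ! (i + 1) - w ! i \<in> gessel_steps" if "i < m"
        proof -
          let ?d = "w ! (i + 1) - w ! i"
          have "\<xi> (Suc i) \<omega> = of_int (fst ?d)" "\<eta> (Suc i) \<omega> = of_int (fst ?d - 2 * snd ?d)"
            using S[of i] S[of "Suc i"] T[of i] T[of "Suc i"] that by simp_all
          moreover have "of_int k \<in> {1, -1 :: real} \<longleftrightarrow> k \<in> {1, -1}" for k :: int
            by (simp, linarith)
          ultimately show ?thesis
            unfolding gessel_step_iff using signs that by metis
        qed
        \<comment> \<open>\<open>E\<close> constrains times from 1 on; at time 0 both sums are 0.
          The second inequality gives the sign of the second coordinate, which is half the
          difference of the sums.\<close>
        have "partial_sum \<xi> i \<omega> \<ge> 0 \<and> partial_sum \<xi> i \<omega> \<ge> partial_sum \<eta> i \<omega>" if "i \<le> m"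
          using E that by (cases "i = 0") (simp_all add: E_def)
        then show "fst (w ! i) \<ge> 0" "snd (w ! i) \<ge> 0" if "i \<le> m"
          using that S[of i] T[of i] by simp_all
      qed
      moreover have "\<omega> \<in> A w"
        using \<omega> S T by (simp add: A_def)
      ultimately show "\<omega> \<in> (\<Union>w\<in>W. A w)" by blast
    }
    {
      assume "\<omega> \<in> (\<Union>w\<in>W. A w)"
      then obtain w where w: "w \<in> W" "\<omega> \<in> A w" by blast
      then show "\<omega> \<in> E"
        using steps(3,4)[OF w(1)] by (simp add: A_def E_def)
    }
  qed
  then have "prob E = prob (\<Union>w\<in>W. A w)"
    by (intro measure_eq_AE) (auto simp: W_def finite_gessel_walks)
  also have "\<dots> = (\<Sum>w\<in>W. prob (A w))"
    using disj by (intro finite_measure_finite_Union) (auto simp: W_def finite_gessel_walks)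
  \<comment> \<open>All summands are equal, so the sum is the number of walks times
    \<open>(1/4) ^ m\<close>.\<close>
  also have "\<dots> = real (gessel_number m n1 n2) / 4 ^ m"
    by (simp add: prob_A gessel_number_def W_def power_one_over)
  finally show ?thesis
    by (simp add: E_def)
qed

theorem lemma1:
  fixes M :: "'a measure" and \<xi> \<eta> :: "nat \<Rightarrow> 'a \<Rightarrow> real"
  assumes "prob_space M"
    and "prob_space.indep_vars M (\<lambda>_. borel) (case_sum \<xi> \<eta>) ({1..} <+> {1..})"
    and "\<And>i. i \<ge> 1 \<Longrightarrow> \<P>(\<omega> in M. \<xi> i \<omega> = 1) = 1/2 \<and> \<P>(\<omega> in M. \<xi> i \<omega> = -1) = 1/2"
    and "\<And>i. i \<ge> 1 \<Longrightarrow> \<P>(\<omega> in M. \<eta> i \<omega> = 1) = 1/2 \<and> \<P>(\<omega> in M. \<eta> i \<omega> = -1) = 1/2"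
  shows "(\<forall>(m::nat) (n1::int) (n2::int). n1 \<ge> 0 \<longrightarrow> n2 \<ge> 0 \<longrightarrow>
            real (gessel_number m n1 n2) =
              4 ^ m * \<P>(\<omega> in M.
                (\<forall>j\<in>{1..m}. partial_sum \<xi> j \<omega> \<ge> 0 \<and> partial_sum \<xi> j \<omega> \<ge> partial_sum \<eta> j \<omega>) \<and>
                partial_sum \<xi> m \<omega> = of_int n1 \<and>
                partial_sum \<eta> m \<omega> = of_int (n1 - 2 * n2))) \<and>
         (\<forall>n::nat.
            real (gessel_number (2 * n) 0 0) =
              4 ^ (2 * n) * \<P>(\<omega> in M.
                (\<forall>j\<in>{1..2 * n}. partial_sum \<xi> j \<omega> \<ge> 0 \<and> partial_sum \<xi> j \<omega> \<ge> partial_sum \<eta> j \<omega>) \<and>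
                partial_sum \<xi> (2 * n) \<omega> = 0 \<and> partial_sum \<eta> (2 * n) \<omega> = 0))"
proof -
  interpret prob_space M by fact
  note * = gessel_number_eq_prob[OF assms(2-4)]
  show ?thesis
    using * *[of _ 0 0] by simp
qed

end
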